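(* For every positive integer $n$, the set of monomials $B_{\mathfrak{B}_n}^{(1,2)}$ has cardinality $4^n\,n!$.
   Context: A type $B$ modified Motzkin path of length $n$ is a lattice path $\pi=(p_1,\ldots,p_n)$ in $\mathbb{Z}^2$ starting at $(0,0)$ whose $i$-th step $p_i$ is one of: an (undecorated) up-step $(1,1)$; a horizontal step $(1,0)$ with decoration $\theta_i$; a horizontal step $(1,0)$ with decoration $\xi_i$; a down-step $(1,-1)$ with decoration $\theta_i\xi_i$; such that the path never goes below the line $y=0$. The set of these paths is $\Pi(n)_{\ge0}$. For $\pi\in\Pi(n)_{\ge0}$ let $T(\pi)$ (resp. $S(\pi)$) be the set of indices $i\in\{1,\ldots,n\}$ such that $\theta_i$ (resp. $\xi_i$) occurs in the decoration of $p_i$. For $T,S\subseteq\{1,\ldots,n\}$ define $\beta(T,S)=(\beta_1(T,S),\ldots,\beta_n(T,S))$ by $\beta_1(T,S)=-1+\chi(1\notin T)+\chi(1\notin S)$ and, for $2\le i\le n$, $\beta_i(T,S)=\beta_{i-1}(T,S)-2+\chi(i\notin T)+\chi(i-1\notin T)+\chi(i\notin S)+\chi(i-1\notin S)$, where $\chi(P)=1$ if $P$ is true and $0$ otherwise. The variables $x_i$ commute with all variables; the variables $\theta_i,\xi_i$ anticommute with one another. $\theta_T,\xi_S$ denote products in increasing order of indices and $x^\beta=x_1^{\beta_1}\cdots x_n^{\beta_n}$. Then $B_{\mathfrak{B}_n}^{(1,2)}$ is the set of monomials $x^\beta\theta_T\xi_S$ such that $(T,S)=(T(\pi),S(\pi))$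 for some $\pi\in\Pi(n)_{\ge0}$ and $0\le\beta_i\le\beta_i(T,S)$ for all $i\in\{1,\ldots,n\}$. (Signs of monomials are irrelevant; an element is determined by the triple $(\beta,T,S)$.) *)

theory Defs
  imports Main "HOL-Library.Product_Plus" "HOL-Library.Poly_Mapping"
begin

text \<open>Type B modified Motzkin paths. The decoration of the \<open>i\<close>-th step carries the index \<open>i\<close>, so
  it is determined by the kind of the step together with its (1-based) position in the path.\<close>

datatype motzkin_step = Up | Hor_theta | Hor_xi | Down_theta_xi

fun step_vec :: "motzkin_step \<Rightarrow> int \<times> int" where
  "step_vec Up = (1, 1)"
| "step_vec Hor_theta = (1, 0)"
| "step_vec Hor_xi = (1, 0)"
| "step_vec Down_theta_xi = (1, -1)"

definition path_point :: "motzkin_step list \<Rightarrow> nat \<Rightarrow> int \<times> int" where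
  "path_point \<pi> k = sum_list (map step_vec (take k \<pi>))"

definition motzkin_paths :: "nat \<Rightarrow> motzkin_step list set" where
  "motzkin_paths n = {\<pi>. length \<pi> = n \<and> (\<forall>k\<le>n. 0 \<le> snd (path_point \<pi> k))}"

definition theta_set :: "motzkin_step list \<Rightarrow> nat set" where
  "theta_set \<pi> = {i \<in> {1..length \<pi>}. \<pi> ! (i - 1) \<in> {Hor_theta, Down_theta_xi}}"

definition xi_set :: "motzkin_step list \<Rightarrow> nat set" where
  "xi_set \<pi> = {i \<in> {1..length \<pi>}. \<pi> ! (i - 1) \<in> {Hor_xi, Down_theta_xi}}"

text \<open>Indices start at 1; the value at 0 is a dummy that is never used. The bounds are
  integers, as they can be negative for general \<open>T\<close> and \<open>S\<close>.\<close>

fun beta_bound :: "nat set \<Rightarrow> nat set \<Rightarrow> nat \<Rightarrow> int" where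
  "beta_bound T S 0 = 0"
| "beta_bound T S (Suc 0) = - 1 + of_bool (1 \<notin> T) + of_bool (1 \<notin> S)"
| "beta_bound T S (Suc (Suc j)) =
     beta_bound T S (Suc j) - 2
       + of_bool (Suc (Suc j) \<notin> T) + of_bool (Suc j \<notin> T)
       + of_bool (Suc (Suc j) \<notin> S) + of_bool (Suc j \<notin> S)"

text \<open>The monomial \<open>x\<^sup>\<beta> \<theta>\<^sub>T \<xi>\<^sub>S\<close> (up to sign) is represented by the triple
  \<open>(\<beta>, T, S)\<close>; the exponent vector \<open>\<beta>\<close> is a finitely supported function, zero outside the
  indices of the variables \<open>x\<^sub>1, \<dots>, x\<^sub>n\<close>.\<close>

type_synonym super_monomial = "(nat \<Rightarrow>\<^sub>0 nat) \<times> nat set \<times> nat set"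

definition B_monomials :: "nat \<Rightarrow> super_monomial set" where
  "B_monomials n =
     {(\<beta>, T, S). Poly_Mapping.keys \<beta> \<subseteq> {1..n} \<and>
        (\<exists>\<pi> \<in> motzkin_paths n. T = theta_set \<pi> \<and> S = xi_set \<pi>) \<and>
        (\<forall>i \<in> {1..n}. int (Poly_Mapping.lookup \<beta> i) \<le> beta_bound T S i)}"

end

theory Submission
  imports Defs "HOL-Library.FuncSet"
begin

text \<open>If \<open>h\<^sub>i\<close> is the height of \<open>\<pi>\<close> after \<open>i\<close> steps, then \<open>\<beta>\<^sub>i(T(\<pi>),S(\<pi>)) = h\<^sub>i\<^sub>-\<^sub>1 + h\<^sub>i\<close>, so \<open>\<pi>\<close>
  contributes \<open>\<Prod>\<^sub>i (h\<^sub>i\<^sub>-\<^sub>1 + h\<^sub>i + 1)\<close> monomials. The generating polynomial of the total weight of the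
  paths by final height is obtained from 1 by iterating the operator \<open>2(x+1)\<^sup>2 d/dx + 2(x+1)\<close>, hence equals
  \<open>2\<^sup>n n! (x+1)\<^sup>n\<close>; now put \<open>x = 1\<close>.\<close>

definition step_height :: "motzkin_step \<Rightarrow> int" where
  "step_height s = snd (step_vec s)"

definition height :: "motzkin_step list \<Rightarrow> nat \<Rightarrow> int" where
  "height \<pi> k = snd (path_point \<pi> k)"

lemma step_height_simps [simp]:
  "step_height Up = 1" "step_height Hor_theta = 0" "step_height Hor_xi = 0"
  "step_height Down_theta_xi = - 1"
  by (simp_all add: step_height_def)

lemma UNIV_motzkin_step: "(UNIV :: motzkin_step set) = {Up, Hor_theta, Hor_xi, Down_theta_xi}"
  using motzkin_step.exhaust by auto

lemma finite_UNIV_motzkin_step: "finite (UNIV :: motzkin_step set)"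
  by (simp add: UNIV_motzkin_step)

lemma height_0 [simp]: "height \<pi> 0 = 0"
  by (simp add: height_def path_point_def)

lemma height_Suc: "k < length \<pi> \<Longrightarrow> height \<pi> (Suc k) = height \<pi> k + step_height (\<pi> ! k)"
  by (simp add: height_def path_point_def take_Suc_conv_app_nth step_height_def)

lemma height_append: "k \<le> length \<pi> \<Longrightarrow> height (\<pi> @ \<sigma>) k = height \<pi> k"
  by (simp add: height_def path_point_def)

lemma height_snoc: "height (\<pi> @ [s]) (Suc (length \<pi>)) = height \<pi> (length \<pi>) + step_height s"
  by (simp add: height_Suc height_append)

lemma motzkin_paths_altdef:
  "motzkin_paths n = {\<pi>. length \<pi> = n \<and> (\<forall>k\<le>n. 0 \<le> height \<pi> k)}"
  by (simp add: motzkin_paths_def height_def)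

lemma finite_motzkin_paths: "finite (motzkin_paths n)"
  by (rule finite_subset[OF _ finite_lists_length_eq[OF finite_UNIV_motzkin_step, of n]])
     (auto simp: motzkin_paths_def)

lemma motzkin_paths_snoc:
  "\<pi> @ [s] \<in> motzkin_paths (Suc n) \<longleftrightarrow> \<pi> \<in> motzkin_paths n \<and> 0 \<le> height \<pi> n + step_height s"
  by (auto simp: motzkin_paths_altdef le_Suc_eq height_append height_snoc)

text \<open>Each of the two possible decorations lowers a step by one below the up-step: a step
  carrying d decorations has height 1 - d, while the left-hand side is 2 - d.\<close>

lemma of_bool_theta_xi:
  assumes "i < length \<pi>"
  shows "of_bool (Suc i \<notin> theta_set \<pi>) + of_bool (Suc i \<notin> xi_set \<pi>) = step_height (\<pi> ! i) + 1"
  using assms by (cases "\<pi> ! i") (simp_all add: theta_set_def xi_set_def)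

text \<open>By \<open>of_bool_theta_xi\<close>, each application of the recurrence adds the heights
  of two consecutive steps. This is exactly the change from one sum of adjacent path heights to the
  next, so the bounds telescope.\<close>

lemma beta_bound_eq_heights:
  assumes "i < length \<pi>"
  shows "beta_bound (theta_set \<pi>) (xi_set \<pi>) (Suc i) = height \<pi> i + height \<pi> (Suc i)"
  using assms
proof (induction i)
  case 0
  then show ?case using of_bool_theta_xi[of 0 \<pi>] by (simp add: height_Suc)
next
  case (Suc i)
  then show ?case
    using of_bool_theta_xi[of i \<pi>] of_bool_theta_xi[of "Suc i" \<pi>] by (simp add: height_Suc)
qed

text \<open>The four kinds of step realise the four subsets of the two decorations, so the two sets
  reveal every step. The lengths have to agree because trailing up-steps leave no trace in either
  set.\<close>

lemma theta_xi_inject: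
  assumes len: "length \<pi> = length \<sigma>"
    and T: "theta_set \<pi> = theta_set \<sigma>" and S: "xi_set \<pi> = xi_set \<sigma>"
  shows "\<pi> = \<sigma>"
proof (rule nth_equalityI[OF len])
  fix i assume i: "i < length \<pi>"
  have "Suc i \<in> theta_set \<pi> \<longleftrightarrow> Suc i \<in> theta_set \<sigma>" "Suc i \<in> xi_set \<pi> \<longleftrightarrow> Suc i \<in> xi_set \<sigma>"
    using T S by auto
  then show "\<pi> ! i = \<sigma> ! i"
    using i len by (cases "\<pi> ! i"; cases "\<sigma> ! i") (simp_all add: theta_set_def xi_set_def)
qed

text \<open>This turns bounded exponent vectors into a box, whose cardinality is a product.
  Restriction and extension by zero translate between the default 0 of a polynomial mapping and the
  default \<open>undefined\<close> of \<open>PiE\<close>.\<close>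

lemma bij_betw_poly_mapping_PiE:
  fixes b :: "nat \<Rightarrow> nat"
  assumes "finite A"
  shows "bij_betw (\<lambda>\<beta>. restrict (Poly_Mapping.lookup \<beta>) A)
    {\<beta>. Poly_Mapping.keys \<beta> \<subseteq> A \<and> (\<forall>i\<in>A. Poly_Mapping.lookup \<beta> i \<le> b i)} (\<Pi>\<^sub>E i\<in>A. {..b i})"
proof (rule bij_betw_byWitness[where f' = "\<lambda>f. Abs_poly_mapping (\<lambda>i. if i \<in> A then f i else 0)"])
  have lookup: "Poly_Mapping.lookup (Abs_poly_mapping (\<lambda>i. if i \<in> A then f i else 0))
      = (\<lambda>i. if i \<in> A then f i else 0)" for f :: "nat \<Rightarrow> nat"
    by (rule lookup_Abs_poly_mapping) (rule finite_subset[OF _ assms], auto)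
  show "\<forall>\<beta>\<in>{\<beta>. Poly_Mapping.keys \<beta> \<subseteq> A \<and> (\<forall>i\<in>A. Poly_Mapping.lookup \<beta> i \<le> b i)}.
      Abs_poly_mapping (\<lambda>i. if i \<in> A then restrict (Poly_Mapping.lookup \<beta>) A i else 0) = \<beta>"
    by (auto intro!: poly_mapping_eqI simp: lookup in_keys_iff)
  show "\<forall>f\<in>\<Pi>\<^sub>E i\<in>A. {..b i}.
      restrict (Poly_Mapping.lookup (Abs_poly_mapping (\<lambda>i. if i \<in> A then f i else 0))) A = f"
    by (simp add: lookup cong: restrict_cong)
  show "(\<lambda>\<beta>. restrict (Poly_Mapping.lookup \<beta>) A) `
      {\<beta>. Poly_Mapping.keys \<beta> \<subseteq> A \<and> (\<forall>i\<in>A. Poly_Mapping.lookup \<beta> i \<le> b i)} \<subseteq> (\<Pi>\<^sub>E i\<in>A. {..b i})"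
    by auto
  show "(\<lambda>f. Abs_poly_mapping (\<lambda>i. if i \<in> A then f i else 0)) ` (\<Pi>\<^sub>E i\<in>A. {..b i})
      \<subseteq> {\<beta>. Poly_Mapping.keys \<beta> \<subseteq> A \<and> (\<forall>i\<in>A. Poly_Mapping.lookup \<beta> i \<le> b i)}"
    by (auto simp: lookup in_keys_iff split: if_splits)
qed

definition exponents :: "motzkin_step list \<Rightarrow> (nat \<Rightarrow>\<^sub>0 nat) set" where
  "exponents \<pi> = {\<beta>. Poly_Mapping.keys \<beta> \<subseteq> {1..length \<pi>} \<and>
     (\<forall>i\<in>{1..length \<pi>}. int (Poly_Mapping.lookup \<beta> i) \<le> beta_bound (theta_set \<pi>) (xi_set \<pi>) i)}"

text \<open>By \<open>beta_bound_eq_heights\<close>, the factor at \<open>i\<close> counts the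
  admissible exponents of the variable with index \<open>Suc i\<close>.\<close>

definition weight :: "motzkin_step list \<Rightarrow> nat" where
  "weight \<pi> = (\<Prod>i<length \<pi>. nat (height \<pi> i + height \<pi> (Suc i) + 1))"

lemma weight_snoc:
  "weight (\<pi> @ [s]) = weight \<pi> * nat (2 * height \<pi> (length \<pi>) + step_height s + 1)"
  by (simp add: weight_def height_append height_snoc algebra_simps)

lemma exponents_finite_card:
  assumes "\<pi> \<in> motzkin_paths n"
  shows "finite (exponents \<pi>)" "card (exponents \<pi>) = weight \<pi>"
proof -
  define b where "b i = nat (beta_bound (theta_set \<pi>) (xi_set \<pi>) i)" for i
  have len: "length \<pi> = n" and nonneg: "\<And>k. k \<le> n \<Longrightarrow> 0 \<le> height \<pi> k"
    using assms by (auto simp: motzkin_paths_altdef)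
  have bound: "beta_bound (theta_set \<pi>) (xi_set \<pi>) (Suc i) = height \<pi> i + height \<pi> (Suc i)"
    "0 \<le> height \<pi> i + height \<pi> (Suc i)" if "i < n" for i
    using that beta_bound_eq_heights[of i \<pi>] nonneg[of i] nonneg[of "Suc i"] len by auto
  \<comment> \<open>Nonnegative heights make the bounds nonnegative, so passing to \<open>b\<close>
    through \<open>nat\<close> does not change the inequalities.\<close>
  have "0 \<le> beta_bound (theta_set \<pi>) (xi_set \<pi>) i" if "i \<in> {1..n}" for i
    using that bound[of "i - 1"] by auto
  then have eq: "exponents \<pi> = {\<beta>. Poly_Mapping.keys \<beta> \<subseteq> {1..n} \<and>
      (\<forall>i\<in>{1..n}. Poly_Mapping.lookup \<beta> i \<le> b i)}"
    unfolding exponents_def len b_def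
    by (intro Collect_cong conj_cong ball_cong refl) (simp only: le_nat_iff)
  note bij = bij_betw_poly_mapping_PiE[of "{1..n}" b, folded eq, OF finite_atLeastAtMost]
  show "finite (exponents \<pi>)"
    using bij_betw_finite[OF bij] by (simp add: finite_PiE)
  have "card (exponents \<pi>) = (\<Prod>i\<in>{1..n}. b i + 1)"
    using bij_betw_same_card[OF bij] by (simp add: card_PiE)
  also have "\<dots> = (\<Prod>i<n. b (Suc i) + 1)"
    by (rule prod.reindex_bij_witness[where i = Suc and j = "\<lambda>i. i - 1"]) auto
  also have "\<dots> = weight \<pi>"
    unfolding weight_def len by (rule prod.cong) (auto simp: b_def bound nat_add_distrib)
  finally show "card (exponents \<pi>) = weight \<pi>" .
qed

text \<open>Since a path can be recovered from its decorations, the monomials split into disjoint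
  blocks, one for each path.\<close>

lemma card_B_monomials: "card (B_monomials n) = sum weight (motzkin_paths n)"
proof -
  define monomials where "monomials \<pi> = exponents \<pi> \<times> {theta_set \<pi>} \<times> {xi_set \<pi>}" for \<pi>
  have "B_monomials n = (\<Union>\<pi>\<in>motzkin_paths n. monomials \<pi>)"
    unfolding B_monomials_def monomials_def exponents_def
    by (fastforce simp: motzkin_paths_def)
  moreover have "monomials \<pi> \<inter> monomials \<sigma> = {}"
    if "\<pi> \<in> motzkin_paths n" "\<sigma> \<in> motzkin_paths n" "\<pi> \<noteq> \<sigma>" for \<pi> \<sigma>
    using that theta_xi_inject[of \<pi> \<sigma>] by (auto simp: monomials_def motzkin_paths_def)
  moreover have "finite (monomials \<pi>)" if "\<pi> \<in> motzkin_paths n" for \<pi>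
    using that by (simp add: monomials_def exponents_finite_card)
  ultimately have "card (B_monomials n) = (\<Sum>\<pi>\<in>motzkin_paths n. card (monomials \<pi>))"
    using card_UN_disjoint[OF finite_motzkin_paths, of n monomials] by metis
  also have "\<dots> = sum weight (motzkin_paths n)"
    by (intro sum.cong) (auto simp: monomials_def card_cartesian_product exponents_finite_card)
  finally show ?thesis .
qed

text \<open>The final height is an integer so that removing an up-step from height 0 makes sense: it
  leads to height -1, where the set is empty.\<close>

definition paths_ending :: "nat \<Rightarrow> int \<Rightarrow> motzkin_step list set" where
  "paths_ending n k = {\<pi> \<in> motzkin_paths n. height \<pi> n = k}"

lemma finite_paths_ending: "finite (paths_ending n k)"
  by (simp add: paths_ending_def finite_motzkin_paths)

lemma paths_ending_Suc:
  assumes "0 \<le> k"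
  shows "paths_ending (Suc n) k
    = (\<Union>s\<in>UNIV. (\<lambda>\<pi>. \<pi> @ [s]) ` paths_ending n (k - step_height s))"
proof (intro set_eqI iffI)
  fix \<pi> assume \<pi>: "\<pi> \<in> paths_ending (Suc n) k"
  then have "length \<pi> = Suc n" by (simp add: paths_ending_def motzkin_paths_def)
  then obtain \<sigma> s where \<sigma>: "\<pi> = \<sigma> @ [s]" "length \<sigma> = n"
    by (metis length_Suc_conv_rev)
  with \<pi> have "\<sigma> \<in> paths_ending n (k - step_height s)"
    using height_snoc[of \<sigma> s] by (simp add: paths_ending_def motzkin_paths_snoc)
  with \<sigma> show "\<pi> \<in> (\<Union>s\<in>UNIV. (\<lambda>\<pi>. \<pi> @ [s]) ` paths_ending n (k - step_height s))"
    by auto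
next
  fix \<pi> assume "\<pi> \<in> (\<Union>s\<in>UNIV. (\<lambda>\<pi>. \<pi> @ [s]) ` paths_ending n (k - step_height s))"
  then obtain \<sigma> s where \<sigma>: "\<pi> = \<sigma> @ [s]" "\<sigma> \<in> paths_ending n (k - step_height s)" by auto
  then have "length \<sigma> = n" by (simp add: paths_ending_def motzkin_paths_def)
  with \<sigma> assms show "\<pi> \<in> paths_ending (Suc n) k"
    using height_snoc[of \<sigma> s] by (simp add: paths_ending_def motzkin_paths_snoc)
qed

text \<open>A last step \<open>s\<close> ending at \<open>k\<close> starts at
  \<open>k - step_height s\<close>; the sum of these two heights plus 1 is the new factor of the
  weight.\<close>

lemma sum_weight_paths_ending_Suc:
  assumes "0 \<le> k"
  shows "sum weight (paths_ending (Suc n) k)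
    = (\<Sum>s\<in>UNIV. sum weight (paths_ending n (k - step_height s)) * nat (2 * k - step_height s + 1))"
proof -
  have "sum weight (paths_ending (Suc n) k)
      = (\<Sum>s\<in>UNIV. sum weight ((\<lambda>\<pi>. \<pi> @ [s]) ` paths_ending n (k - step_height s)))"
    unfolding paths_ending_Suc[OF assms]
    by (rule sum.UNION_disjoint) (auto simp: finite_UNIV_motzkin_step finite_paths_ending)
  also have "\<dots> = (\<Sum>s\<in>UNIV. \<Sum>\<pi>\<in>paths_ending n (k - step_height s). weight (\<pi> @ [s]))"
    by (rule sum.cong) (auto simp: sum.reindex inj_on_def)
  also have "\<dots> = (\<Sum>s\<in>UNIV. sum weight (paths_ending n (k - step_height s))
      * nat (2 * k - step_height s + 1))"
    unfolding sum_distrib_right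
    by (intro sum.cong refl) (auto simp: weight_snoc paths_ending_def motzkin_paths_def algebra_simps)
  finally show ?thesis .
qed

text \<open>With D = d/dx, this compares the coefficients of x^(j+1) in ((x+1)^2 D + (x+1)) (x+1)^n
  = (n+1) (x+1)^(n+1). It is the sum of two absorption identities, expanded and recombined by
  Pascal's rule.\<close>

lemma binomial_recurrence:
  "Suc j * (n choose j) + (2 * Suc j + 1) * (n choose Suc j) + (Suc j + 1) * (n choose Suc (Suc j))
    = Suc n * (Suc n choose Suc j)"
proof -
  have "Suc j * (n choose j) + Suc j * (n choose Suc j) = Suc n * (n choose j)"
    using Suc_times_binomial_eq[of n j] by (simp add: algebra_simps)
  moreover have "Suc (Suc j) * (n choose Suc j) + Suc (Suc j) * (n choose Suc (Suc j))
      = Suc n * (n choose Suc j)"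
    using Suc_times_binomial_eq[of n "Suc j"] by (simp add: algebra_simps)
  ultimately show ?thesis by (simp add: algebra_simps)
qed

lemma sum_weight_paths_ending:
  "sum weight (paths_ending n (int k)) = 2 ^ n * fact n * (n choose k)"
proof (induction n arbitrary: k)
  case 0
  have "paths_ending 0 (int k) = (if k = 0 then {[]} else {})"
    by (auto simp: paths_ending_def motzkin_paths_altdef)
  then show ?case by (cases k) (simp_all add: weight_def)
next
  case (Suc n)
  let ?G = "\<lambda>k. sum weight (paths_ending n k)"
  \<comment> \<open>The factors \<open>2 * k\<close>, \<open>2 * k + 1\<close> and
    \<open>2 * k + 2\<close> belong to a last step that is up, horizontal or down; the middle term
    is doubled for the two kinds of horizontal step.\<close>
  have rec: "sum weight (paths_ending (Suc n) (int k))
      = ?G (int k - 1) * (2 * k) + 2 * (?G (int k) * (2 * k + 1)) + ?G (int (Suc k)) * (2 * k + 2)"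
    by (simp add: sum_weight_paths_ending_Suc UNIV_motzkin_step nat_add_distrib nat_mult_distrib
        algebra_simps)
  show ?case
  proof (cases k)
    case 0
    \<comment> \<open>The term at height -1 has factor 0. Heights 0 and 1 contribute 2 + 2n times
      \<open>2 ^ n * fact n\<close>.\<close>
    then show ?thesis unfolding rec Suc.IH by (simp add: Suc.IH[of 0, simplified] algebra_simps)
  next
    case (Suc j)
    then have pred: "int k - 1 = int j" by simp
    have "sum weight (paths_ending (Suc n) (int k)) = 2 ^ Suc n * fact n *
        (Suc j * (n choose j) + (2 * Suc j + 1) * (n choose Suc j)
          + (Suc j + 1) * (n choose Suc (Suc j)))"
      unfolding rec pred Suc.IH unfolding Suc by (simp add: algebra_simps)
    also have "\<dots> = 2 ^ Suc n * fact (Suc n) * (Suc n choose k)"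
      unfolding binomial_recurrence Suc by (simp add: algebra_simps)
    finally show ?thesis .
  qed
qed

lemma height_le_length:
  assumes "k \<le> length \<pi>"
  shows "height \<pi> k \<le> int k"
  using assms
proof (induction k)
  case (Suc k)
  then show ?case by (cases "\<pi> ! k") (auto simp: height_Suc)
qed simp

theorem theorem9p10:
  fixes n :: nat
  assumes "n \<ge> 1"
  shows "card (B_monomials n) = 4 ^ n * fact n"
proof -
  \<comment> \<open>Paths are sorted by final height, which is at most \<open>n\<close> because no
    step rises by more than one.\<close>
  have "motzkin_paths n = (\<Union>k\<in>{..n}. paths_ending n (int k))"
  proof (intro set_eqI iffI)
    fix \<pi> assume \<pi>: "\<pi> \<in> motzkin_paths n"
    then have "0 \<le> height \<pi> n" "height \<pi> n \<le> int n"
      using height_le_length[of n \<pi>] by (auto simp: motzkin_paths_altdef)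
    with \<pi> show "\<pi> \<in> (\<Union>k\<in>{..n}. paths_ending n (int k))"
      by (auto simp: paths_ending_def intro!: bexI[of _ "nat (height \<pi> n)"])
  qed (auto simp: paths_ending_def)
  then have "sum weight (motzkin_paths n) = sum weight (\<Union>k\<in>{..n}. paths_ending n (int k))"
    by simp
  also have "\<dots> = (\<Sum>k\<le>n. sum weight (paths_ending n (int k)))"
    by (rule sum.UNION_disjoint) (auto simp: finite_motzkin_paths paths_ending_def)
  also have "\<dots> = 2 ^ n * fact n * (\<Sum>k\<le>n. n choose k)"
    by (simp add: sum_weight_paths_ending sum_distrib_left)
  \<comment> \<open>The second factor \<open>2 ^ n\<close> is the row sum of the binomial
    coefficients, that is, (x+1)^n at x = 1.\<close>
  also have "\<dots> = (2 * 2) ^ n * fact n"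
    unfolding choose_row_sum power_mult_distrib by simp
  finally show ?thesis by (simp add: card_B_monomials)
qed

end
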